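(* Let $f:\mathbb{R}^n\to\mathbb{R}$, $x^0\in\mathbb{R}^n$, $S=[s^1\cdots s^p]\in\mathbb{R}^{n\times p}$, $T_i=[t_i^1\cdots t_i^{q_i}]\in\mathbb{R}^{n\times q_i}$ for $i=1,\ldots,p$, and $$Y=\{x^0\}\cup\{x^0+s^i:1\le i\le p\}\cup\{x^0+t_i^j:1\le i\le p,\,1\le j\le q_i\}\cup\{x^0+s^i+t_i^j:1\le i\le p,\,1\le j\le q_i\}.$$ Suppose that $Y$ lies in the $d$-dimensional affine space $\mathcal{Y}=\{x^0+Q\widehat{x}:\widehat{x}\in\mathbb{R}^d\}$, where $d<n$ and $Q\in\mathbb{R}^{n\times d}$ has $d$ orthonormal columns. Let $\widehat{f}(\widehat{x})=f(x^0+Q\widehat{x})$ for $\widehat{x}\in\mathbb{R}^d$, and let $\widehat{Y}=\{\widehat{y}\in\mathbb{R}^d:x^0+Q\widehat{y}\in Y\}$. Then a quadratic generalized simplex derivative (QGSD) model $m_{\mathrm{QGSD}}^{x^0,Y}$ of $f$ at $x^0$ over $Y$ and the corresponding QGSD model $\widehat{m}_{\mathrm{QGSD}}^{0,\widehat{Y}}$ of $\widehat{f}$ at $0$ over $\widehat{Y}$ satisfy $$m_{\mathrm{QGSD}}^{x^0,Y}(x)=\widehat{m}_{\mathrm{QGSD}}^{0,\widehat{Y}}(\widehat{x})\quad\text{for all }(x,\widehat{x})\in\mathbb{R}^n\times\mathbb{R}^d\text{ with }x\in(x^0+Q\widehat{x})+\mathrm{col}(Q)^\perp.$$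
   Context: $A^\dagger$ denotes the Moore–Penrose pseudoinverse of a matrix $A$; $\mathrm{col}(Q)^\perp$ is the orthogonal complement of the column space of $Q$. Generalized simplex gradient (GSG). For $g:\mathbb{R}^k\to\mathbb{R}$, $z\in\mathbb{R}^k$ and $A=[a^1\cdots a^q]\in\mathbb{R}^{k\times q}$, $$\nabla_sg(z;A)=(A^\top)^\dagger\begin{bmatrix}g(z+a^1)-g(z)\\ \vdots\\ g(z+a^q)-g(z)\end{bmatrix}\in\mathbb{R}^k.$$ It uses the points $z$ and $z+a^j$. Generalized simplex Hessian (GSH). For $g:\mathbb{R}^k\to\mathbb{R}$, $z\in\mathbb{R}^k$, $A=[a^1\cdots a^r]\in\mathbb{R}^{k\times r}$ and an indexed family $B_{1:r}$ of matrices $B_i=[b_i^1\cdots b_i^{l_i}]\in\mathbb{R}^{k\times l_i}$, $i=1,\ldots,r$, $$\nabla_s^2g(z;A;B_{1:r})=(A^\top)^\dagger\begin{bmatrix}\left(\nabla_sg(z+a^1;B_1)-\nabla_sg(z;B_1)\right)^\top\\ \vdots\\ \left(\nabla_sg(z+a^r;B_r)-\nabla_sg(z;B_r)\right)^\top\end{bmatrix}\in\mathbb{R}^{k\times k}.$$ It uses the points $z$, $z+a^i$, $z+b_i^j$, $z+a^i+b_i^j$. QGSD models. A QGSD model of $f$ at $x^0$ over $Y$ is a function $$m_{\mathrm{QGSD}}^{x^0,Y}(x)=f(x^0)+\nabla_{\mathrm{QGSD}}f(x^0;Y)^\top(x-x^0)+\tfrac12(x-x^0)^\top\nabla^2_{\mathrm{QGSD}}f(x^0;Y)(x-x^0),$$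 where $\nabla_{\mathrm{QGSD}}f(x^0;Y)\in\mathbb{R}^n$ is a finite linear combination of GSGs of $f$ and $\nabla^2_{\mathrm{QGSD}}f(x^0;Y)\in\mathbb{R}^{n\times n}$ is a finite linear combination of GSHs of $f$ (transposes of GSHs are also allowed, e.g. for symmetrization), all of which use only points of $Y$, chosen such that the union of all points used in both constructions equals $Y$. Examples: $\nabla_{\mathrm{QGSD}}f(x^0;Y)=\nabla_sf(x^0;S)$ and $\nabla^2_{\mathrm{QGSD}}f(x^0;Y)=\nabla_s^2f(x^0;S;T_{1:p})$ or its symmetric part; or, when all $T_i=S$, $\nabla_{\mathrm{QGSD}}f(x^0;Y)=2\nabla_sf(x^0;S)-\nabla_sf(x^0;2S)$ and $\nabla^2_{\mathrm{QGSD}}f(x^0;Y)=\nabla_s^2f(x^0;S;T_{1:p})$. Corresponding subspace model. Every point of $Y$ is uniquely $x^0+Q\widehat{y}$ with $\widehat{y}\in\widehat{Y}$, and the direction matrices $A$, $B_i$ of the GSGs $\nabla_sf(x^0+Q\widehat{y};A)$ and GSHs $\nabla_s^2f(x^0+Q\widehat{y};A;B_{1:r})$ whose linear combinations form $\nabla_{\mathrm{QGSD}}f(x^0;Y)$ and $\nabla^2_{\mathrm{QGSD}}f(x^0;Y)$ are of the form $A=Q\widehat{A}$, $B_i=Q\widehat{B}_i$ with unique $\widehat{A},\widehat{B}_i$. The corresponding QGSD model of $\widehat{f}$ at $0$ over $\widehat{Y}$ is $$\widehat{m}_{\mathrm{QGSD}}^{0,\widehat{Y}}(\widehat{x})=\widehat{f}(0)+\nabla_{\mathrm{QGSD}}\widehat{f}(0;\widehat{Y})^\top\widehat{x}+\tfrac12\widehat{x}^\top\nabla^2_{\mathrm{QGSD}}\widehat{f}(0;\widehat{Y})\widehat{x},$$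 where $\nabla_{\mathrm{QGSD}}\widehat{f}(0;\widehat{Y})$ and $\nabla^2_{\mathrm{QGSD}}\widehat{f}(0;\widehat{Y})$ are the linear combinations with the same coefficients in which each $\nabla_sf(x^0+Q\widehat{y};A)$ is replaced by $\nabla_s\widehat{f}(\widehat{y};\widehat{A})$ and each $\nabla_s^2f(x^0+Q\widehat{y};A;B_{1:r})$ by $\nabla_s^2\widehat{f}(\widehat{y};\widehat{A};\widehat{B}_{1:r})$ (and likewise for transposes). *)

theory Defs
  imports "Jordan_Normal_Form.VS_Connect"
begin

text \<open>
  Points of $\mathbb{R}^k$ are elements of \<open>carrier_vec k\<close>, so that the number of directions may
  vary within one formula. Column and family indices start at 0. A function on $\mathbb{R}^k$ has
  type \<open>real vec \<Rightarrow> real\<close>; only its values on \<open>carrier_vec k\<close> matter.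
\<close>

definition is_pseudoinverse :: "real mat \<Rightarrow> real mat \<Rightarrow> bool" where
  "is_pseudoinverse A X \<longleftrightarrow>
     X \<in> carrier_mat (dim_col A) (dim_row A) \<and>
     A * X * A = A \<and> X * A * X = X \<and>
     (A * X)\<^sup>T = A * X \<and> (X * A)\<^sup>T = X * A"

lemma is_pseudoinverse_unique:
  assumes X: "is_pseudoinverse A X" and Y: "is_pseudoinverse A Y"
  shows "X = Y"
proof -
  define m k where "m = dim_row A" and "k = dim_col A"
  have A: "A \<in> carrier_mat m k" unfolding m_def k_def by auto
  have cX: "X \<in> carrier_mat k m" and cY: "Y \<in> carrier_mat k m"
    using X Y unfolding is_pseudoinverse_def m_def k_def by auto
  have AX: "(A * X)\<^sup>T = A * X" and XA: "(X * A)\<^sup>T = X * A"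
    and AXA: "A * X * A = A" and XAX: "X * A * X = X"
    using X unfolding is_pseudoinverse_def by auto
  have AY: "(A * Y)\<^sup>T = A * Y" and YA: "(Y * A)\<^sup>T = Y * A"
    and AYA: "A * Y * A = A" and YAY: "Y * A * Y = Y"
    using Y unfolding is_pseudoinverse_def by auto
  have cAX: "A * X \<in> carrier_mat m m" and cAY: "A * Y \<in> carrier_mat m m"
    and cXA: "X * A \<in> carrier_mat k k" and cYA: "Y * A \<in> carrier_mat k k"
    using A cX cY by auto
  have "A * X = (A * Y) * (A * X)"
    using AYA assoc_mult_mat[OF cAY A cX] by simp
  also have "\<dots> = (A * Y)\<^sup>T * (A * X)\<^sup>T" using AX AY by simp
  also have "\<dots> = ((A * X) * (A * Y))\<^sup>T" using transpose_mult[OF cAX cAY] by simp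
  also have "(A * X) * (A * Y) = A * Y"
    using AXA assoc_mult_mat[OF cAX A cY] by simp
  finally have eq1: "A * X = A * Y" using AY by simp
  have "X * A = (X * A) * (Y * A)"
    using AYA assoc_mult_mat[OF cX A cYA] assoc_mult_mat[OF A cY A] by simp
  also have "\<dots> = (X * A)\<^sup>T * (Y * A)\<^sup>T" using XA YA by simp
  also have "\<dots> = ((Y * A) * (X * A))\<^sup>T" using transpose_mult[OF cYA cXA] by simp
  also have "(Y * A) * (X * A) = Y * A"
    using AXA assoc_mult_mat[OF cY A cXA] assoc_mult_mat[OF A cX A] by simp
  finally have eq2: "X * A = Y * A" using YA by simp
  have "X = (Y * A) * X" using XAX eq2 by simp
  also have "\<dots> = Y * (A * Y)" using assoc_mult_mat[OF cY A cX] eq1 by simp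
  also have "\<dots> = Y" using assoc_mult_mat[OF cY A cY] YAY by simp
  finally show ?thesis .
qed

definition pseudoinverse :: "real mat \<Rightarrow> real mat" where
  "pseudoinverse A = (THE X. is_pseudoinverse A X)"

definition orthonormal_cols :: "real mat \<Rightarrow> bool" where
  "orthonormal_cols Q \<longleftrightarrow>
     (\<forall>i<dim_col Q. \<forall>j<dim_col Q. col Q i \<bullet> col Q j = (if i = j then 1 else 0))"

definition col_perp :: "real mat \<Rightarrow> real vec set" where
  "col_perp Q =
     vec_module.orthogonal_complement (dim_row Q) (vec_space.col_space (dim_row Q) Q)"


subsection \<open>Generalized simplex gradient and Hessian\<close>

definition gsg :: "(real vec \<Rightarrow> real) \<Rightarrow> real vec \<Rightarrow> real mat \<Rightarrow> real vec" where
  "gsg g z A = pseudoinverse A\<^sup>T *\<^sub>v vec (dim_col A) (\<lambda>j. g (z + col A j) - g z)"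

definition gsg_points :: "real vec \<Rightarrow> real mat \<Rightarrow> real vec set" where
  "gsg_points z A = {z} \<union> {z + col A j |j. j < dim_col A}"

definition gsh :: "(real vec \<Rightarrow> real) \<Rightarrow> real vec \<Rightarrow> real mat \<Rightarrow> real mat list \<Rightarrow> real mat" where
  "gsh g z A Bs = pseudoinverse A\<^sup>T *
     mat_of_rows (dim_row A)
       (map (\<lambda>i. gsg g (z + col A i) (Bs ! i) - gsg g z (Bs ! i)) [0..<dim_col A])"

definition gsh_points :: "real vec \<Rightarrow> real mat \<Rightarrow> real mat list \<Rightarrow> real vec set" where
  "gsh_points z A Bs =
     {z} \<union> {z + col A i |i. i < dim_col A}
     \<union> {z + col (Bs ! i) j |i j. i < dim_col A \<and> j < dim_col (Bs ! i)}
     \<union> {z + col A i + col (Bs ! i) j |i j. i < dim_col A \<and> j < dim_col (Bs ! i)}"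


subsection \<open>QGSD models\<close>

text \<open>
  One summand of a linear combination: a coefficient together with the arguments of the GSG or GSH.
  The Boolean flag in \<open>GSH_term\<close> says whether the transpose of the GSH is taken. The function is not
  part of the data, so the same data can be evaluated for different functions.
\<close>

datatype gsg_term = GSG_term real "real vec" "real mat"
datatype gsh_term = GSH_term real bool "real vec" "real mat" "real mat list"

fun wf_gsg_term :: "nat \<Rightarrow> gsg_term \<Rightarrow> bool" where
  "wf_gsg_term k (GSG_term c z A) \<longleftrightarrow> z \<in> carrier_vec k \<and> dim_row A = k"

fun wf_gsh_term :: "nat \<Rightarrow> gsh_term \<Rightarrow> bool" where
  "wf_gsh_term k (GSH_term c tr z A Bs) \<longleftrightarrow>
     z \<in> carrier_vec k \<and> dim_row A = k \<and> length Bs = dim_col A \<and> (\<forall>B\<in>set Bs. dim_row B = k)"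

fun gsg_term_points :: "gsg_term \<Rightarrow> real vec set" where
  "gsg_term_points (GSG_term c z A) = gsg_points z A"

fun gsh_term_points :: "gsh_term \<Rightarrow> real vec set" where
  "gsh_term_points (GSH_term c tr z A Bs) = gsh_points z A Bs"

fun eval_gsg_term :: "(real vec \<Rightarrow> real) \<Rightarrow> gsg_term \<Rightarrow> real vec" where
  "eval_gsg_term g (GSG_term c z A) = c \<cdot>\<^sub>v gsg g z A"

fun eval_gsh_term :: "(real vec \<Rightarrow> real) \<Rightarrow> gsh_term \<Rightarrow> real mat" where
  "eval_gsh_term g (GSH_term c tr z A Bs) =
     c \<cdot>\<^sub>m (if tr then (gsh g z A Bs)\<^sup>T else gsh g z A Bs)"

definition is_qgsd_data :: "nat \<Rightarrow> real vec set \<Rightarrow> gsg_term list \<Rightarrow> gsh_term list \<Rightarrow> bool" where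
  "is_qgsd_data k Y gs hs \<longleftrightarrow>
     (\<forall>t\<in>set gs. wf_gsg_term k t) \<and> (\<forall>t\<in>set hs. wf_gsh_term k t) \<and>
     (\<Union>t\<in>set gs. gsg_term_points t) \<union> (\<Union>t\<in>set hs. gsh_term_points t) = Y"

lemma is_qgsd_data_standard:
  assumes "x0 \<in> carrier_vec n" "S \<in> carrier_mat n p" "length Ts = p"
    and "\<forall>B\<in>set Ts. dim_row B = n"
  shows "is_qgsd_data n (gsh_points x0 S Ts) [GSG_term 1 x0 S] [GSH_term 1 False x0 S Ts]"
  using assms by (auto simp: is_qgsd_data_def gsg_points_def gsh_points_def)

definition qgsd_gradient :: "nat \<Rightarrow> (real vec \<Rightarrow> real) \<Rightarrow> gsg_term list \<Rightarrow> real vec" where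
  "qgsd_gradient k g gs = foldr (\<lambda>t v. eval_gsg_term g t + v) gs (0\<^sub>v k)"

definition qgsd_hessian :: "nat \<Rightarrow> (real vec \<Rightarrow> real) \<Rightarrow> gsh_term list \<Rightarrow> real mat" where
  "qgsd_hessian k g hs = foldr (\<lambda>t M. eval_gsh_term g t + M) hs (0\<^sub>m k k)"

definition qgsd_model ::
  "(real vec \<Rightarrow> real) \<Rightarrow> real vec \<Rightarrow> gsg_term list \<Rightarrow> gsh_term list \<Rightarrow> real vec \<Rightarrow> real" where
  "qgsd_model g x0 gs hs x =
     g x0 + qgsd_gradient (dim_vec x0) g gs \<bullet> (x - x0)
     + 1 / 2 * ((x - x0) \<bullet> (qgsd_hessian (dim_vec x0) g hs *\<^sub>v (x - x0)))"


subsection \<open>The corresponding data in the subspace\<close>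

definition hat_point :: "real vec \<Rightarrow> real mat \<Rightarrow> real vec set \<Rightarrow> real vec \<Rightarrow> real vec" where
  "hat_point x0 Q Yhat y = (THE yhat. yhat \<in> Yhat \<and> y = x0 + Q *\<^sub>v yhat)"

definition hat_dirs :: "real mat \<Rightarrow> real mat \<Rightarrow> real mat" where
  "hat_dirs Q A = (THE Ahat. Ahat \<in> carrier_mat (dim_col Q) (dim_col A) \<and> A = Q * Ahat)"

fun hat_gsg_term :: "real vec \<Rightarrow> real mat \<Rightarrow> real vec set \<Rightarrow> gsg_term \<Rightarrow> gsg_term" where
  "hat_gsg_term x0 Q Yhat (GSG_term c z A) =
     GSG_term c (hat_point x0 Q Yhat z) (hat_dirs Q A)"

fun hat_gsh_term :: "real vec \<Rightarrow> real mat \<Rightarrow> real vec set \<Rightarrow> gsh_term \<Rightarrow> gsh_term" where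
  "hat_gsh_term x0 Q Yhat (GSH_term c tr z A Bs) =
     GSH_term c tr (hat_point x0 Q Yhat z) (hat_dirs Q A) (map (hat_dirs Q) Bs)"

text \<open>
  The descriptions above are well defined, and they turn data over \<open>Y\<close> into data over \<open>Yhat\<close>.
\<close>

context
  fixes n d :: nat and x0 :: "real vec" and Q :: "real mat" and Y Yhat :: "real vec set"
  assumes x0: "x0 \<in> carrier_vec n"
    and Q: "Q \<in> carrier_mat n d"
    and orth: "orthonormal_cols Q"
    and Y: "Y \<subseteq> {x0 + Q *\<^sub>v u |u. u \<in> carrier_vec d}"
    and Yhat: "Yhat = {u \<in> carrier_vec d. x0 + Q *\<^sub>v u \<in> Y}"
begin

lemma transpose_mult_self: "Q\<^sup>T * Q = 1\<^sub>m d"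
  using Q orth by (intro eq_matI) (auto simp: orthonormal_cols_def)

lemma mult_vec_inj:
  assumes u: "u \<in> carrier_vec d" and v: "v \<in> carrier_vec d" and eq: "Q *\<^sub>v u = Q *\<^sub>v v"
  shows "u = v"
proof -
  have "Q\<^sup>T *\<^sub>v (Q *\<^sub>v w) = w" if "w \<in> carrier_vec d" for w
    using that Q transpose_mult_self assoc_mult_mat_vec[of "Q\<^sup>T" d n Q d w] by auto
  with u v eq show ?thesis by metis
qed

lemma add_cancel_base:
  fixes v w x :: "real vec"
  assumes "v \<in> carrier_vec n" "w \<in> carrier_vec n" "x \<in> carrier_vec n" "x + v = x + w"
  shows "v = w"
proof (rule eq_vecI)
  fix i assume i: "i < dim_vec w"
  have "(x + v) $ i = (x + w) $ i" using assms(4) by simp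
  then show "v $ i = w $ i" using i assms(1-3) by auto
qed (use assms in auto)

lemma embed_inj:
  assumes u: "u \<in> carrier_vec d" and v: "v \<in> carrier_vec d"
    and eq: "x0 + Q *\<^sub>v u = x0 + Q *\<^sub>v v"
  shows "u = v"
  using mult_vec_inj[OF u v add_cancel_base[OF _ _ x0 eq]] Q u v by auto

lemma ex1_hat_point:
  assumes "y \<in> Y"
  shows "\<exists>!yhat. yhat \<in> Yhat \<and> y = x0 + Q *\<^sub>v yhat"
  using assms Y Yhat embed_inj by auto

lemma hat_point:
  assumes "y \<in> Y"
  shows "hat_point x0 Q Yhat y \<in> Yhat" "y = x0 + Q *\<^sub>v hat_point x0 Q Yhat y"
  using theI'[OF ex1_hat_point[OF assms]] unfolding hat_point_def by auto

lemma ex1_hat_dirs: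
  assumes A: "dim_row A = n"
    and cols: "\<And>j. j < dim_col A \<Longrightarrow> \<exists>u \<in> carrier_vec d. col A j = Q *\<^sub>v u"
  shows "\<exists>!Ahat. Ahat \<in> carrier_mat (dim_col Q) (dim_col A) \<and> A = Q * Ahat"
proof -
  obtain u where u: "\<And>j. j < dim_col A \<Longrightarrow> u j \<in> carrier_vec d \<and> col A j = Q *\<^sub>v u j"
    using cols by metis
  define B where "B = mat_of_cols d (map u [0..<dim_col A])"
  have B: "B \<in> carrier_mat d (dim_col A)" unfolding B_def by (simp add: mat_of_cols_def)
  have colB: "col B j = u j" if "j < dim_col A" for j
    unfolding B_def using that u by (simp add: col_mat_of_cols)
  have "A = Q * B"
  proof (rule mat_col_eqI)
    fix j assume j: "j < dim_col (Q * B)"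
    then show "col A j = col (Q * B) j"
      using B Q u[of j] colB[of j] col_mult2[OF Q B, of j] by auto
  qed (use A B Q in auto)
  moreover have "C = B" if C: "C \<in> carrier_mat d (dim_col A)" and eq: "A = Q * C" for C
  proof (rule mat_col_eqI)
    fix j assume j: "j < dim_col B"
    have "Q *\<^sub>v col C j = Q *\<^sub>v col B j"
      using j B eq \<open>A = Q * B\<close> col_mult2[OF Q B, of j] col_mult2[OF Q C, of j]
      by (metis carrier_matD(2))
    then show "col C j = col B j"
      by (rule mult_vec_inj[rotated 2]) (use B C in auto)
  qed (use B C in auto)
  ultimately show ?thesis
    using B unfolding carrier_matD(2)[OF Q] by blast
qed

lemma hat_dirs:
  assumes A: "dim_row A = n"
    and z: "z \<in> Y" "\<And>j. j < dim_col A \<Longrightarrow> z + col A j \<in> Y"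
  shows "hat_dirs Q A \<in> carrier_mat d (dim_col A)" "A = Q * hat_dirs Q A"
proof -
  have "\<exists>u \<in> carrier_vec d. col A j = Q *\<^sub>v u" if j: "j < dim_col A" for j
  proof -
    obtain u where u: "u \<in> carrier_vec d" "z = x0 + Q *\<^sub>v u" using z Y by auto
    obtain v where v: "v \<in> carrier_vec d" "z + col A j = x0 + Q *\<^sub>v v" using z(2)[OF j] Y by auto
    have cj: "col A j \<in> carrier_vec n" using A by (simp add: col_dim carrier_vecI)
    have "col A j = Q *\<^sub>v (v - u)"
    proof (rule add_cancel_base[of _ _ z])
      have "z + Q *\<^sub>v (v - u) = x0 + Q *\<^sub>v u + (Q *\<^sub>v v - Q *\<^sub>v u)"
        using u v Q by (simp add: mult_minus_distrib_mat_vec)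
      also have "\<dots> = x0 + Q *\<^sub>v v" using x0 u v Q by (auto simp: vec_eq_iff)
      finally show "z + col A j = z + Q *\<^sub>v (v - u)" using v by simp
    qed (use cj u v Q x0 in auto)
    then show ?thesis using u v by auto
  qed
  from theI'[OF ex1_hat_dirs[OF A this]]
  show "hat_dirs Q A \<in> carrier_mat d (dim_col A)" "A = Q * hat_dirs Q A"
    using Q unfolding hat_dirs_def by auto
qed

lemma collect_image: "g ` {h i |i. i < (k :: nat)} = {g (h i) |i. i < k}"
  by blast

lemma embed_add:
  assumes "u \<in> carrier_vec d" "v \<in> carrier_vec d"
  shows "x0 + Q *\<^sub>v (u + v) = x0 + Q *\<^sub>v u + Q *\<^sub>v v"
  using assms x0 Q
  by (simp add: mult_add_distrib_mat_vec[OF Q] assoc_add_vec[where n = n])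

lemma hat_gsg_term:
  assumes wf: "wf_gsg_term n t" and sub: "gsg_term_points t \<subseteq> Y"
  shows "wf_gsg_term d (hat_gsg_term x0 Q Yhat t)"
    and "gsg_term_points (hat_gsg_term x0 Q Yhat t) \<subseteq> carrier_vec d"
    and "(\<lambda>u. x0 + Q *\<^sub>v u) ` gsg_term_points (hat_gsg_term x0 Q Yhat t) = gsg_term_points t"
proof -
  obtain c z A where t: "t = GSG_term c z A" by (cases t)
  have A: "dim_row A = n" and z: "z \<in> Y" and zA: "\<And>j. j < dim_col A \<Longrightarrow> z + col A j \<in> Y"
    using wf sub unfolding t by (auto simp: gsg_points_def)
  define zh Ah where "zh = hat_point x0 Q Yhat z" and "Ah = hat_dirs Q A"
  have zh: "zh \<in> carrier_vec d" "x0 + Q *\<^sub>v zh = z"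
    using hat_point[OF z] Yhat unfolding zh_def by auto
  have Ah: "Ah \<in> carrier_mat d (dim_col A)" "A = Q * Ah"
    using hat_dirs[OF A z zA] unfolding Ah_def by auto
  have colA: "col A j = Q *\<^sub>v col Ah j" if "j < dim_col A" for j
    using that Ah(2) col_mult2[OF Q Ah(1)] by metis
  have cAh: "col Ah j \<in> carrier_vec d" for j using Ah(1) by auto
  have th: "hat_gsg_term x0 Q Yhat t = GSG_term c zh Ah" unfolding t zh_def Ah_def by simp
  show "wf_gsg_term d (hat_gsg_term x0 Q Yhat t)" using zh Ah(1) unfolding th by auto
  show "gsg_term_points (hat_gsg_term x0 Q Yhat t) \<subseteq> carrier_vec d"
    using zh cAh unfolding th by (auto simp: gsg_points_def)
  have e: "x0 + Q *\<^sub>v (zh + col Ah j) = z + col A j" if "j < dim_col A" for j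
    using embed_add[OF zh(1) cAh] zh colA[OF that] by simp
  have dAh: "dim_col Ah = dim_col A" using Ah(1) by auto
  let ?E = "\<lambda>u. x0 + Q *\<^sub>v u"
  have i1: "?E ` {zh + col Ah j |j. j < dim_col Ah} = {z + col A j |j. j < dim_col A}"
    unfolding dAh collect_image by (intro Collect_cong) (metis e)
  show "?E ` gsg_term_points (hat_gsg_term x0 Q Yhat t) = gsg_term_points t"
    unfolding th unfolding t gsg_term_points.simps gsg_points_def image_Un i1 using zh(2) by simp
qed

lemma hat_gsh_term:
  assumes wf: "wf_gsh_term n t" and sub: "gsh_term_points t \<subseteq> Y"
  shows "wf_gsh_term d (hat_gsh_term x0 Q Yhat t)"
    and "gsh_term_points (hat_gsh_term x0 Q Yhat t) \<subseteq> carrier_vec d"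
    and "(\<lambda>u. x0 + Q *\<^sub>v u) ` gsh_term_points (hat_gsh_term x0 Q Yhat t) = gsh_term_points t"
proof -
  obtain c tr z A Bs where t: "t = GSH_term c tr z A Bs" by (cases t)
  have A: "dim_row A = n" and z: "z \<in> Y" and zA: "\<And>j. j < dim_col A \<Longrightarrow> z + col A j \<in> Y"
    and len: "length Bs = dim_col A"
    using wf sub unfolding t by (auto simp: gsh_points_def)
  have zB: "z + col (Bs ! i) j \<in> Y" if "i < dim_col A" "j < dim_col (Bs ! i)" for i j
    using sub that unfolding t gsh_term_points.simps gsh_points_def by blast
  have B: "dim_row (Bs ! i) = n" if "i < dim_col A" for i
    using wf len that unfolding t by auto
  define zh Ah Bh where "zh = hat_point x0 Q Yhat z" and "Ah = hat_dirs Q A"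
    and "Bh = map (hat_dirs Q) Bs"
  have zh: "zh \<in> carrier_vec d" "x0 + Q *\<^sub>v zh = z"
    using hat_point[OF z] Yhat unfolding zh_def by auto
  have Ah: "Ah \<in> carrier_mat d (dim_col A)" "A = Q * Ah"
    using hat_dirs[OF A z zA] unfolding Ah_def by auto
  have Bh_nth: "Bh ! i = hat_dirs Q (Bs ! i)" if "i < dim_col A" for i
    using that len unfolding Bh_def by simp
  have Bh: "Bh ! i \<in> carrier_mat d (dim_col (Bs ! i))" "Bs ! i = Q * Bh ! i"
    if "i < dim_col A" for i
    unfolding Bh_nth[OF that] by (rule hat_dirs[OF B[OF that] z zB[OF that]]; assumption)+
  have colA: "col A j = Q *\<^sub>v col Ah j" if "j < dim_col A" for j
    using that Ah(2) col_mult2[OF Q Ah(1)] by metis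
  have colB: "col (Bs ! i) j = Q *\<^sub>v col (Bh ! i) j"
    if "i < dim_col A" "j < dim_col (Bs ! i)" for i j
    using that Bh(2) col_mult2[OF Q Bh(1)] by metis
  have cAh: "col Ah j \<in> carrier_vec d" for j using Ah(1) by auto
  have cBh: "col (Bh ! i) j \<in> carrier_vec d" if "i < dim_col A" for i j
    using Bh(1)[OF that] by auto
  have dAh: "dim_col Ah = dim_col A" using Ah(1) by auto
  have dBh: "dim_col (Bh ! i) = dim_col (Bs ! i)" if "i < dim_col A" for i
    using Bh(1)[OF that] by auto
  have th: "hat_gsh_term x0 Q Yhat t = GSH_term c tr zh Ah Bh"
    unfolding t zh_def Ah_def Bh_def by simp
  have "dim_row M = d" if "M \<in> set Bh" for M
    using that Bh(1) len unfolding in_set_conv_nth by (fastforce simp: Bh_def)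
  then show "wf_gsh_term d (hat_gsh_term x0 Q Yhat t)"
    using zh Ah(1) len unfolding th by (auto simp: Bh_def)
  show "gsh_term_points (hat_gsh_term x0 Q Yhat t) \<subseteq> carrier_vec d"
    using zh cAh cBh dAh unfolding th by (auto simp: gsh_points_def)
  have e1: "x0 + Q *\<^sub>v (zh + col Ah j) = z + col A j" if "j < dim_col A" for j
    using embed_add[OF zh(1) cAh] zh colA[OF that] by simp
  have e2: "x0 + Q *\<^sub>v (zh + col (Bh ! i) j) = z + col (Bs ! i) j"
    if "i < dim_col A" "j < dim_col (Bs ! i)" for i j
    using embed_add[OF zh(1) cBh] zh colB[OF that] that by simp
  have e3: "x0 + Q *\<^sub>v (zh + col Ah i + col (Bh ! i) j) = z + col A i + col (Bs ! i) j"
    if "i < dim_col A" "j < dim_col (Bs ! i)" for i j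
    using embed_add[OF add_carrier_vec[OF zh(1) cAh] cBh] e1 colB[OF that] that by simp
  let ?E = "\<lambda>u. x0 + Q *\<^sub>v u"
  have i1: "?E ` {zh + col Ah i |i. i < dim_col Ah} = {z + col A i |i. i < dim_col A}"
    unfolding dAh collect_image by (intro Collect_cong) (metis e1)
  have i2: "?E ` {zh + col (Bh ! i) j |i j. i < dim_col Ah \<and> j < dim_col (Bh ! i)}
    = {z + col (Bs ! i) j |i j. i < dim_col A \<and> j < dim_col (Bs ! i)}" (is "?l = ?r")
  proof
    show "?l \<subseteq> ?r" using e2 dBh unfolding dAh by fastforce
    show "?r \<subseteq> ?l"
    proof
      fix y assume "y \<in> ?r"
      then obtain i j where ij: "i < dim_col A" "j < dim_col (Bs ! i)" "y = z + col (Bs ! i) j"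
        by auto
      have "zh + col (Bh ! i) j \<in> {zh + col (Bh ! i) j |i j. i < dim_col Ah \<and> j < dim_col (Bh ! i)}"
        unfolding mem_Collect_eq using ij dBh dAh by metis
      then show "y \<in> ?l" using ij(3) e2[OF ij(1,2)] by (metis (no_types, lifting) image_eqI)
    qed
  qed
  have i3: "?E ` {zh + col Ah i + col (Bh ! i) j |i j. i < dim_col Ah \<and> j < dim_col (Bh ! i)}
    = {z + col A i + col (Bs ! i) j |i j. i < dim_col A \<and> j < dim_col (Bs ! i)}" (is "?l = ?r")
  proof
    show "?l \<subseteq> ?r" using e3 dBh unfolding dAh by fastforce
    show "?r \<subseteq> ?l"
    proof
      fix y assume "y \<in> ?r"
      then obtain i j where ij: "i < dim_col A" "j < dim_col (Bs ! i)"
        "y = z + col A i + col (Bs ! i) j" by auto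
      have "zh + col Ah i + col (Bh ! i) j
        \<in> {zh + col Ah i + col (Bh ! i) j |i j. i < dim_col Ah \<and> j < dim_col (Bh ! i)}"
        unfolding mem_Collect_eq using ij dBh dAh by metis
      then show "y \<in> ?l" using ij(3) e3[OF ij(1,2)] by (metis (no_types, lifting) image_eqI)
    qed
  qed
  show "?E ` gsh_term_points (hat_gsh_term x0 Q Yhat t) = gsh_term_points t"
    unfolding th unfolding t gsh_term_points.simps gsh_points_def image_Un i1 i2 i3
    using zh(2) by simp
qed

lemma is_qgsd_data_hat:
  assumes data: "is_qgsd_data n Y gs hs"
  shows "is_qgsd_data d Yhat (map (hat_gsg_term x0 Q Yhat) gs) (map (hat_gsh_term x0 Q Yhat) hs)"
proof -
  have g: "wf_gsg_term n t" "gsg_term_points t \<subseteq> Y" if "t \<in> set gs" for t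
    using data that unfolding is_qgsd_data_def by auto
  have h: "wf_gsh_term n t" "gsh_term_points t \<subseteq> Y" if "t \<in> set hs" for t
    using data that unfolding is_qgsd_data_def by auto
  let ?E = "\<lambda>u. x0 + Q *\<^sub>v u"
  let ?P = "(\<Union>t\<in>set gs. gsg_term_points (hat_gsg_term x0 Q Yhat t))
    \<union> (\<Union>t\<in>set hs. gsh_term_points (hat_gsh_term x0 Q Yhat t))"
  have P: "?P \<subseteq> carrier_vec d"
    using hat_gsg_term(2)[OF g] hat_gsh_term(2)[OF h] by blast
  have img: "?E ` ?P = Y"
    using data hat_gsg_term(3)[OF g] hat_gsh_term(3)[OF h]
    unfolding is_qgsd_data_def image_Un image_UN by simp
  have "Yhat \<subseteq> ?P"
  proof
    fix u assume "u \<in> Yhat"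
    then have u: "u \<in> carrier_vec d" "?E u \<in> ?E ` ?P" using Yhat img by auto
    then obtain v where v: "v \<in> ?P" "?E u = ?E v" by blast
    have "v \<in> carrier_vec d" using P v(1) by (rule subsetD)
    from embed_inj[OF u(1) this v(2)] v(1) show "u \<in> ?P" by (simp only:)
  qed
  moreover have "?P \<subseteq> Yhat" using P img Yhat by blast
  ultimately have "?P = Yhat" by (rule subset_antisym[rotated])
  then show ?thesis
    using hat_gsg_term(1)[OF g] hat_gsh_term(1)[OF h] unfolding is_qgsd_data_def by auto
qed

end

end

theory Submission
  imports Defs
begin

text \<open>
  Since \<open>Q\<^sup>T * Q = 1\<close>, the Moore--Penrose conditions give \<open>(A\<^sup>T * Q\<^sup>T)\<^sup>\<dagger> = Q * (A\<^sup>T)\<^sup>\<dagger>\<close>. Hence the GSG of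
  \<open>f\<close> with directions \<open>Q * A\<close> is \<open>Q\<close> times the GSG of \<open>fhat\<close> with directions \<open>A\<close>, and the GSH of \<open>f\<close> is
  \<open>Q * H * Q\<^sup>T\<close> with \<open>H\<close> the GSH of \<open>fhat\<close>. Both relations survive linear combinations, and
  \<open>Q\<^sup>T (x - x0) = xhat\<close> turns one model into the other. As the pseudoinverse is given by a definite
  description, its existence has to be proved as well.
\<close>

section \<open>Existence of the real Moore-Penrose pseudoinverse\<close>

text \<open>
  Wedderburn rank reduction: with a pivot \<open>A $$ (i,j) \<noteq> 0\<close> and \<open>P\<close> supported at \<open>(j,i)\<close>, the matrix
  \<open>B = A - A * P * A\<close> has fewer nonzero rows, and an inner inverse of \<open>B\<close> lifts to one of \<open>A\<close>
  because \<open>B = A * F = E * A\<close>.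
\<close>

lemma exists_generalized_inverse:
  fixes A :: "'a :: field mat"
  assumes "A \<in> carrier_mat m n"
  shows "\<exists>G \<in> carrier_mat n m. A * G * A = A"
  using assms
proof (induction "card {k. k < m \<and> (\<exists>l<n. A $$ (k,l) \<noteq> 0)}" arbitrary: A rule: less_induct)
  case less
  note A = less.prems
  show ?case
  proof (cases "\<exists>i<m. \<exists>j<n. A $$ (i,j) \<noteq> 0")
    case False
    then have "A = 0\<^sub>m m n" using A by (intro eq_matI) auto
    then show ?thesis by (intro bexI[of _ "0\<^sub>m n m"]) auto
  next
    case True
    then obtain i j where i: "i < m" and j: "j < n" and a: "A $$ (i,j) \<noteq> 0" by blast
    define P where "P = mat n m (\<lambda>(k,l). if k = j \<and> l = i then 1 / A $$ (i,j) else 0)"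
    have P: "P \<in> carrier_mat n m" by (simp add: P_def)
    define B where "B = A - A * P * A"
    have B: "B \<in> carrier_mat m n" using A P by (auto simp: B_def)
    have PA: "(P * A) $$ (k,l) = (if k = j then A $$ (i,l) / A $$ (i,j) else 0)"
      if "k < n" "l < n" for k l
    proof -
      have "(P * A) $$ (k,l) = (\<Sum>t<m. P $$ (k,t) * A $$ (t,l))"
        using that A P by (auto simp: scalar_prod_def lessThan_atLeast0)
      also have "\<dots> = (\<Sum>t<m. if t = i then (if k = j then A $$ (i,l) / A $$ (i,j) else 0) else 0)"
        by (rule sum.cong) (use that in \<open>auto simp: P_def\<close>)
      finally show ?thesis using i by simp
    qed
    have APA: "(A * P * A) $$ (k,l) = A $$ (k,j) * (A $$ (i,l) / A $$ (i,j))"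
      if "k < m" "l < n" for k l
    proof -
      have "(A * P * A) $$ (k,l) = (A * (P * A)) $$ (k,l)" using A P by simp
      also have "\<dots> = (\<Sum>t<n. A $$ (k,t) * (P * A) $$ (t,l))"
        using that A P by (auto simp: scalar_prod_def lessThan_atLeast0)
      also have "\<dots> = (\<Sum>t<n. if t = j then A $$ (k,j) * (A $$ (i,l) / A $$ (i,j)) else 0)"
        by (rule sum.cong) (use that in \<open>auto simp: PA\<close>)
      finally show ?thesis using j by simp
    qed
    have Bkl: "B $$ (k,l) = A $$ (k,l) - A $$ (k,j) * (A $$ (i,l) / A $$ (i,j))"
      if "k < m" "l < n" for k l
      using that A P APA[OF that] by (simp add: B_def)
    \<comment> \<open>A zero row of \<open>A\<close> stays zero in \<open>B\<close>, since the
      correction to row \<open>k\<close> is a multiple of \<open>A $$ (k,j)\<close>. The inclusion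
      is strict because the pivot row \<open>i\<close> is nonzero in \<open>A\<close> and is
      cancelled in \<open>B\<close>.\<close>
    have "{k. k < m \<and> (\<exists>l<n. B $$ (k,l) \<noteq> 0)} \<subset> {k. k < m \<and> (\<exists>l<n. A $$ (k,l) \<noteq> 0)}"
    proof
      show "{k. k < m \<and> (\<exists>l<n. B $$ (k,l) \<noteq> 0)} \<subseteq> {k. k < m \<and> (\<exists>l<n. A $$ (k,l) \<noteq> 0)}"
      proof (intro subsetI CollectI)
        fix k assume "k \<in> {k. k < m \<and> (\<exists>l<n. B $$ (k,l) \<noteq> 0)}"
        then obtain l where k: "k < m" and l: "l < n" "B $$ (k,l) \<noteq> 0" by blast
        then have "A $$ (k,l) \<noteq> 0 \<or> A $$ (k,j) \<noteq> 0" by (auto simp: Bkl)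
        then show "k < m \<and> (\<exists>l<n. A $$ (k,l) \<noteq> 0)" using k l(1) j by blast
      qed
      have "\<not> (\<exists>l<n. B $$ (i,l) \<noteq> 0)" using i a by (simp add: Bkl)
      then show "{k. k < m \<and> (\<exists>l<n. B $$ (k,l) \<noteq> 0)} \<noteq> {k. k < m \<and> (\<exists>l<n. A $$ (k,l) \<noteq> 0)}"
        using i j a by blast
    qed
    then have "card {k. k < m \<and> (\<exists>l<n. B $$ (k,l) \<noteq> 0)} < card {k. k < m \<and> (\<exists>l<n. A $$ (k,l) \<noteq> 0)}"
      by (intro psubset_card_mono) auto
    from less.hyps[OF this B] obtain G where G: "G \<in> carrier_mat n m" and BGB: "B * G * B = B"
      by blast
    define E F where "E = 1\<^sub>m m - A * P" and "F = 1\<^sub>m n - P * A"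
    have E: "E \<in> carrier_mat m m" and F: "F \<in> carrier_mat n n"
      using A P by (auto simp: E_def F_def)
    have AF: "A * F = B"
      using A P mult_minus_distrib_mat[OF A, of "1\<^sub>m n" n "P * A"] by (simp add: F_def B_def)
    have EA: "E * A = B"
      using A P minus_mult_distrib_mat[of "1\<^sub>m m" m m "A * P" A n] by (simp add: E_def B_def)
    have FG: "F * G \<in> carrier_mat n m" and FGE: "F * G * E \<in> carrier_mat n m" using E F G by auto
    \<comment> \<open>The lifted inner inverse is \<open>F * G * E + P\<close>: its first summand
      contributes \<open>B * G * B = B\<close>, its second contributes
      \<open>A * P * A = A - B\<close>, and the two add up to \<open>A\<close>.\<close>
    have "A * (F * G * E + P) * A = A * (F * G * E) * A + A * P * A"
      using A P FGE by (simp add: mult_add_distrib_mat[OF A] add_mult_distrib_mat[of _ m m])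
    also have "A * (F * G * E) * A = A * F * G * (E * A)"
      using assoc_mult_mat[OF A FG E] assoc_mult_mat[OF A F G]
        assoc_mult_mat[OF mult_carrier_mat[OF A FG] E A] by simp
    also have "\<dots> + A * P * A = A"
      using A P APA unfolding AF EA BGB by (intro eq_matI) (auto simp: Bkl)
    finally show ?thesis using FGE P by (intro bexI[of _ "F * G * E + P"]) auto
  qed
qed

text \<open>Each diagonal entry of the Gram matrix is the sum of the squares of the entries of one
  column, and over the reals such a sum vanishes only if every entry does.\<close>

lemma transpose_mult_self_eq_0:
  fixes A :: "real mat"
  assumes "A\<^sup>T * A = 0\<^sub>m (dim_col A) (dim_col A)"
  shows "A = 0\<^sub>m (dim_row A) (dim_col A)"
proof (rule eq_matI)
  fix i j assume ij: "i < dim_row (0\<^sub>m (dim_row A) (dim_col A))" "j < dim_col (0\<^sub>m (dim_row A) (dim_col A))"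
  have "(A\<^sup>T * A) $$ (j,j) = 0" using ij assms by simp
  then have "(\<Sum>k = 0..<dim_row A. A $$ (k,j) * A $$ (k,j)) = 0"
    using ij by (simp add: scalar_prod_def)
  then have "A $$ (i,j) * A $$ (i,j) = 0"
    using ij by (subst (asm) sum_nonneg_eq_0_iff) auto
  then show "A $$ (i,j) = 0\<^sub>m (dim_row A) (dim_col A) $$ (i,j)" using ij by simp
qed auto

text \<open>The difference \<open>D = A * B - A * C\<close> equals \<open>A * (B - C)\<close> and
  satisfies \<open>A\<^sup>T * D = 0\<close>. Hence
  \<open>D\<^sup>T * D = (B - C)\<^sup>T * (A\<^sup>T * D)\<close> is zero, and so is
  \<open>D\<close>.\<close>

lemma gram_mult_cancel:
  fixes A :: "real mat"
  assumes A: "A \<in> carrier_mat m n" and B: "B \<in> carrier_mat n k" and C: "C \<in> carrier_mat n k"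
    and eq: "A\<^sup>T * A * B = A\<^sup>T * A * C"
  shows "A * B = A * C"
proof -
  define D where "D = A * B - A * C"
  have D: "D \<in> carrier_mat m k" using A B C by (auto simp: D_def)
  have At: "A\<^sup>T \<in> carrier_mat n m" using A by simp
  have D': "D = A * (B - C)" using A B C by (simp add: D_def mult_minus_distrib_mat)
  have "A\<^sup>T * D = A\<^sup>T * A * B - A\<^sup>T * A * C"
    unfolding D_def
    using A At B C mult_minus_distrib_mat[OF At, of "A * B" k "A * C"] by simp
  also have "\<dots> = 0\<^sub>m n k" unfolding eq using A C by auto
  finally have AD: "A\<^sup>T * D = 0\<^sub>m n k" .
  have "D\<^sup>T * D = (B - C)\<^sup>T * A\<^sup>T * D"
    unfolding D' using transpose_mult[OF A minus_carrier_mat[OF C]] by simp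
  also have "\<dots> = (B - C)\<^sup>T * (A\<^sup>T * D)"
    using A B C D by (intro assoc_mult_mat[of _ k n _ m]) auto
  also have "\<dots> = 0\<^sub>m k k" unfolding AD using B C by (intro right_mult_zero_mat) auto
  finally have "D = 0\<^sub>m m k" using transpose_mult_self_eq_0[of D] D by auto
  then have *: "(A * B - A * C) $$ (i,j) = 0" if "i < m" "j < k" for i j
    using that unfolding D_def by simp
  show ?thesis
  proof (rule eq_matI)
    fix i j assume "i < dim_row (A * C)" "j < dim_col (A * C)"
    then show "(A * B) $$ (i,j) = (A * C) $$ (i,j)" using *[of i j] A B C by simp
  qed (use A B C in auto)
qed

text \<open>Any inner inverse \<open>G\<close> of the Gram matrix gives the witness
  \<open>W = G * A\<^sup>T\<close>, as for the normal equations of least squares. The identity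
  \<open>A * W * A = A\<close> comes from cancelling \<open>A\<^sup>T\<close> on the left of
  \<open>A\<^sup>T * A * G * (A\<^sup>T * A) = A\<^sup>T * A\<close>.\<close>

lemma exists_least_squares_inverse:
  fixes A :: "real mat"
  assumes A: "A \<in> carrier_mat m n"
  shows "\<exists>W \<in> carrier_mat n m. A * W * A = A \<and> (A * W)\<^sup>T = A * W"
proof -
  have At: "A\<^sup>T \<in> carrier_mat n m" and AtA: "A\<^sup>T * A \<in> carrier_mat n n" using A by auto
  obtain G where G: "G \<in> carrier_mat n n" and AGA: "A\<^sup>T * A * G * (A\<^sup>T * A) = A\<^sup>T * A"
    using exists_generalized_inverse[OF AtA] by blast
  define W where "W = G * A\<^sup>T"
  have W: "W \<in> carrier_mat n m" using G At by (auto simp: W_def)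
  have WA: "W * A = G * (A\<^sup>T * A)" unfolding W_def using G At A by simp
  have "A * (W * A) = A * 1\<^sub>m n"
    unfolding WA using AGA AtA G by (intro gram_mult_cancel[OF A]) auto
  then have AWA: "A * W * A = A" using A W by simp
  define K where "K = A * W"
  have K: "K \<in> carrier_mat m m" using A W by (simp add: K_def)
  have Gt: "G\<^sup>T \<in> carrier_mat n n" using G by simp
  have "K\<^sup>T = W\<^sup>T * A\<^sup>T" unfolding K_def using transpose_mult[OF A W] .
  also have "W\<^sup>T = A * G\<^sup>T" unfolding W_def using transpose_mult[OF G At] by simp
  finally have Kt: "K\<^sup>T = A * (G\<^sup>T * A\<^sup>T)" using A At Gt by simp
  have GAt: "G\<^sup>T * A\<^sup>T \<in> carrier_mat n m" using Gt At by simp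
  \<comment> \<open>\<open>G\<close> need not be symmetric, so the symmetry of \<open>K\<close> is
    obtained indirectly: \<open>K = A * W\<close> fixes everything of the form \<open>A * M\<close>,
    and \<open>K\<^sup>T\<close> has this form. Thus \<open>K\<^sup>T\<close> equals the symmetric
    matrix \<open>K * K\<^sup>T\<close>.\<close>
  have KKt: "K\<^sup>T = K * K\<^sup>T"
    unfolding Kt assoc_mult_mat[OF K A GAt, symmetric] using AWA unfolding K_def by simp
  have "(K * K\<^sup>T)\<^sup>T = K * K\<^sup>T" using transpose_mult[OF K, of "K\<^sup>T" m] K by simp
  then have "K = K\<^sup>T" using KKt by simp
  then show ?thesis using W AWA unfolding K_def by auto
qed

text \<open>
  If \<open>W\<close> and \<open>V\<close> are inner inverses of \<open>A\<close> with \<open>A * W\<close> and \<open>V * A\<close> symmetric, then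
  \<open>V * A * W\<close> is the pseudoinverse.
\<close>

lemma exists_pseudoinverse: "\<exists>X. is_pseudoinverse A X"
proof -
  define m n where "m = dim_row A" and "n = dim_col A"
  have A: "A \<in> carrier_mat m n" and At: "A\<^sup>T \<in> carrier_mat n m" by (auto simp: m_def n_def)
  obtain W where W: "W \<in> carrier_mat n m" and AWA: "A * W * A = A" and AW: "(A * W)\<^sup>T = A * W"
    using exists_least_squares_inverse[OF A] by blast
  \<comment> \<open>The same construction for \<open>A\<^sup>T\<close>, once transposed, yields an
    inner inverse with symmetry on the other side.\<close>
  obtain V' where V': "V' \<in> carrier_mat m n" and AVA': "A\<^sup>T * V' * A\<^sup>T = A\<^sup>T"
    and AV': "(A\<^sup>T * V')\<^sup>T = A\<^sup>T * V'"
    using exists_least_squares_inverse[OF At] by blast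
  define V where "V = V'\<^sup>T"
  have V: "V \<in> carrier_mat n m" using V' by (simp add: V_def)
  have VA: "V * A = A\<^sup>T * V'" using transpose_mult[OF At V'] AV' by (simp add: V_def)
  have "A * (V * A) = (A\<^sup>T * V' * A\<^sup>T)\<^sup>T"
    using transpose_mult[of "A\<^sup>T * V'" n n "A\<^sup>T" m] At V' AV' by (simp add: VA)
  then have AVA: "A * V * A = A" unfolding AVA' using A V by simp
  have cVA: "V * A \<in> carrier_mat n n" using A V by simp
  have VAW: "V * A * W \<in> carrier_mat n m" using cVA W by simp
  \<comment> \<open>With \<open>X = V * A * W\<close>, the products collapse to
    \<open>A * X = A * W\<close> and \<open>X * A = V * A\<close>, from which all four Moore-Penrose
    conditions follow.\<close>
  have AX: "A * (V * A * W) = A * W"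
    using assoc_mult_mat[OF A cVA W] assoc_mult_mat[OF A V A] AVA by simp
  have XA: "V * A * W * A = V * A"
    using assoc_mult_mat[OF cVA W A] assoc_mult_mat[OF V A, of "W * A" n]
      assoc_mult_mat[OF A W A] AWA W A by simp
  have "V * A * (V * A * W) = V * (A * (V * A * W))" using assoc_mult_mat[OF V A VAW] .
  also have "\<dots> = V * A * W" unfolding AX using assoc_mult_mat[OF V A W] by simp
  finally have XAX: "V * A * W * A * (V * A * W) = V * A * W" unfolding XA .
  have "is_pseudoinverse A (V * A * W)"
    unfolding is_pseudoinverse_def XAX unfolding AX XA using VAW AWA AW AV' VA by (simp add: m_def n_def)
  then show ?thesis ..
qed

lemma pseudoinverse: "is_pseudoinverse A (pseudoinverse A)"
  unfolding pseudoinverse_def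
  using theI'[of "is_pseudoinverse A"] exists_pseudoinverse is_pseudoinverse_unique by metis

lemma pseudoinverse_eqI: "is_pseudoinverse A X \<Longrightarrow> pseudoinverse A = X"
  using pseudoinverse is_pseudoinverse_unique by blast

lemma pseudoinverse_carrier:
  "A \<in> carrier_mat m n \<Longrightarrow> pseudoinverse A \<in> carrier_mat n m"
  using pseudoinverse[of A] by (auto simp: is_pseudoinverse_def)

section \<open>Matrix algebra with orthonormal columns\<close>

lemma orthonormal_cols_gram:
  assumes "Q \<in> carrier_mat n d" "orthonormal_cols Q"
  shows "Q\<^sup>T * Q = 1\<^sub>m d"
  using assms by (intro eq_matI) (auto simp: orthonormal_cols_def)

text \<open>Pseudoinverses do not reverse products in general; here \<open>Q\<^sup>T * Q = 1\<close>
  makes it work. With \<open>X\<close> the pseudoinverse of \<open>A\<close>, one product collapses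
  to \<open>A * X\<close> and the other becomes \<open>Q * (X * A) * Q\<^sup>T\<close>, a congruence
  of a symmetric matrix, so uniqueness identifies \<open>Q * X\<close>.\<close>

lemma pseudoinverse_mult_transpose:
  assumes Q: "Q \<in> carrier_mat n d" and orth: "orthonormal_cols Q" and A: "A \<in> carrier_mat m d"
  shows "pseudoinverse (A * Q\<^sup>T) = Q * pseudoinverse A"
proof (rule pseudoinverse_eqI)
  define X where "X = pseudoinverse A"
  have X: "X \<in> carrier_mat d m" using pseudoinverse_carrier[OF A] by (simp add: X_def)
  have AXA: "A * X * A = A" and XAX: "X * A * X = X"
    and AXt: "(A * X)\<^sup>T = A * X" and XAt: "(X * A)\<^sup>T = X * A"
    using pseudoinverse[of A] by (auto simp: is_pseudoinverse_def X_def)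
  have Qt: "Q\<^sup>T \<in> carrier_mat d n" using Q by simp
  have QX: "Q * X \<in> carrier_mat n m" and AQ: "A * Q\<^sup>T \<in> carrier_mat m n"
    and cAX: "A * X \<in> carrier_mat m m" and cXA: "X * A \<in> carrier_mat d d"
    and QXA: "Q * (X * A) \<in> carrier_mat n d" and XAQ: "X * A * Q\<^sup>T \<in> carrier_mat d n"
    using A Q X by auto
  have QtQX: "Q\<^sup>T * (Q * X) = X"
    using assoc_mult_mat[OF Qt Q X] orthonormal_cols_gram[OF Q orth] X by simp
  have 1: "A * Q\<^sup>T * (Q * X) = A * X"
    using assoc_mult_mat[OF A Qt QX] QtQX by simp
  have 2: "Q * X * (A * Q\<^sup>T) = Q * (X * A * Q\<^sup>T)"
    using assoc_mult_mat[OF Q X AQ] assoc_mult_mat[OF X A Qt] by simp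
  have 3: "A * X * (A * Q\<^sup>T) = A * Q\<^sup>T"
    using assoc_mult_mat[OF cAX A Qt] AXA by simp
  have "(Q * (X * A * Q\<^sup>T))\<^sup>T = (X * A * Q\<^sup>T)\<^sup>T * Q\<^sup>T" using transpose_mult[OF Q XAQ] .
  also have "(X * A * Q\<^sup>T)\<^sup>T = Q * (X * A)" using transpose_mult[OF cXA Qt] XAt by simp
  finally have 4: "(Q * (X * A * Q\<^sup>T))\<^sup>T = Q * (X * A * Q\<^sup>T)"
    using assoc_mult_mat[OF Q cXA Qt] by simp
  have "Q * X * (A * Q\<^sup>T) * (Q * X) = Q * X * (A * X)"
    using assoc_mult_mat[OF QX AQ QX] 1 by simp
  also have "\<dots> = Q * X"
    using assoc_mult_mat[OF Q X cAX] assoc_mult_mat[OF X A X] XAX by simp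
  finally have 5: "Q * (X * A * Q\<^sup>T) * (Q * X) = Q * X" unfolding 2 .
  show "is_pseudoinverse (A * Q\<^sup>T) (Q * X)"
    unfolding is_pseudoinverse_def 1 2 using 3 4 5 AXt A Q X by auto
qed

lemma gsg_carrier:
  assumes "A \<in> carrier_mat k r"
  shows "gsg g z A \<in> carrier_vec k"
  using pseudoinverse_carrier[of "A\<^sup>T" r k] assms
  unfolding gsg_def by (auto intro!: mult_mat_vec_carrier)

lemma gsh_carrier:
  assumes "A \<in> carrier_mat k r"
  shows "gsh g z A Bs \<in> carrier_mat k k"
  using pseudoinverse_carrier[of "A\<^sup>T" r k] assms
  unfolding gsh_def by (auto intro!: mult_carrier_mat simp: mat_of_rows_def)

text \<open>This is the source of the right factor \<open>Q\<^sup>T\<close> of the GSH: its rows are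
  transposed gradient differences, and \<open>(Q v)\<^sup>T = v\<^sup>T Q\<^sup>T\<close>.\<close>

lemma mat_of_rows_mult_mat_vec:
  fixes Q :: "'a :: comm_semiring_0 mat"
  assumes Q: "Q \<in> carrier_mat n d" and vs: "set vs \<subseteq> carrier_vec d"
  shows "mat_of_rows n (map ((*\<^sub>v) Q) vs) = mat_of_rows d vs * Q\<^sup>T"
proof (rule eq_matI)
  fix i j assume "i < dim_row (mat_of_rows d vs * Q\<^sup>T)" "j < dim_col (mat_of_rows d vs * Q\<^sup>T)"
  then have i: "i < length vs" and j: "j < n" using Q by auto
  then have v: "vs ! i \<in> carrier_vec d" using vs by auto
  have "row Q j \<bullet> vs ! i = vs ! i \<bullet> row Q j"
    using v Q j by (intro comm_scalar_prod[where n = d]) auto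
  then show "mat_of_rows n (map ((*\<^sub>v) Q) vs) $$ (i,j) = (mat_of_rows d vs * Q\<^sup>T) $$ (i,j)"
    using i j v Q by (simp add: mat_of_rows_index)
qed (use Q in auto)

section \<open>GSG and GSH under the embedding of the subspace\<close>

context
  fixes n d :: nat and x0 :: "real vec" and Q :: "real mat" and f fhat :: "real vec \<Rightarrow> real"
  assumes x0: "x0 \<in> carrier_vec n"
    and Q: "Q \<in> carrier_mat n d"
    and orth: "orthonormal_cols Q"
    and fhat: "\<And>u. u \<in> carrier_vec d \<Longrightarrow> fhat u = f (x0 + Q *\<^sub>v u)"
begin

lemma embed_add_col:
  assumes A: "A \<in> carrier_mat d r" and z: "z \<in> carrier_vec d" and j: "j < r"
  shows "x0 + Q *\<^sub>v z + col (Q * A) j = x0 + Q *\<^sub>v (z + col A j)"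
proof -
  have c: "col A j \<in> carrier_vec d" using A by auto
  show ?thesis
    using col_mult2[OF Q A j] x0 Q z c
    by (simp add: mult_add_distrib_mat_vec[OF Q z c] assoc_add_vec[where n = n])
qed

lemma pseudoinverse_embed:
  assumes A: "A \<in> carrier_mat d r"
  shows "pseudoinverse (Q * A)\<^sup>T = Q * pseudoinverse A\<^sup>T"
  using pseudoinverse_mult_transpose[OF Q orth, of "A\<^sup>T" r] A transpose_mult[OF Q A] by simp

text \<open>Corresponding sample points carry the same function values, so the two difference
  vectors coincide and the factor \<open>Q\<close> comes from the pseudoinverse alone.\<close>

lemma gsg_embed:
  assumes A: "A \<in> carrier_mat d r" and z: "z \<in> carrier_vec d"
  shows "gsg f (x0 + Q *\<^sub>v z) (Q * A) = Q *\<^sub>v gsg fhat z A"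
proof -
  have "f (x0 + Q *\<^sub>v z + col (Q * A) j) - f (x0 + Q *\<^sub>v z) = fhat (z + col A j) - fhat z"
    if "j < r" for j
  proof -
    have "z + col A j \<in> carrier_vec d" using z A by auto
    then show ?thesis using embed_add_col[OF A z that] fhat z by simp
  qed
  then have "vec (dim_col (Q * A)) (\<lambda>j. f (x0 + Q *\<^sub>v z + col (Q * A) j) - f (x0 + Q *\<^sub>v z))
    = vec (dim_col A) (\<lambda>j. fhat (z + col A j) - fhat z)"
    using A by (intro eq_vecI) auto
  then show ?thesis
    unfolding gsg_def pseudoinverse_embed[OF A]
    using Q A pseudoinverse_carrier[of "A\<^sup>T" r d] by (simp add: assoc_mult_mat_vec[of _ n d _ r])
qed

text \<open>The left factor \<open>Q\<close> comes from the pseudoinverse, and the right factor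
  \<open>Q\<^sup>T\<close> from the rows, each of which is \<open>Q\<close> applied to a difference
  of GSGs of \<open>fhat\<close>.\<close>

lemma gsh_embed:
  assumes A: "A \<in> carrier_mat d r" and z: "z \<in> carrier_vec d"
    and len: "length Bs = r" and Bs: "\<forall>B\<in>set Bs. dim_row B = d"
  shows "gsh f (x0 + Q *\<^sub>v z) (Q * A) (map ((*) Q) Bs) = Q * gsh fhat z A Bs * Q\<^sup>T"
proof -
  define v where "v i = gsg fhat (z + col A i) (Bs ! i) - gsg fhat z (Bs ! i)" for i
  have row: "gsg f (x0 + Q *\<^sub>v z + col (Q * A) i) (map ((*) Q) Bs ! i)
      - gsg f (x0 + Q *\<^sub>v z) (map ((*) Q) Bs ! i) = Q *\<^sub>v v i"
    and v: "v i \<in> carrier_vec d" if i: "i < r" for i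
  proof -
    have B: "Bs ! i \<in> carrier_mat d (dim_col (Bs ! i))" using Bs len i by auto
    have "z + col A i \<in> carrier_vec d" using z A by auto
    from gsg_embed[OF B this] gsg_embed[OF B z]
    show "gsg f (x0 + Q *\<^sub>v z + col (Q * A) i) (map ((*) Q) Bs ! i)
      - gsg f (x0 + Q *\<^sub>v z) (map ((*) Q) Bs ! i) = Q *\<^sub>v v i"
      using i len gsg_carrier[OF B] unfolding embed_add_col[OF A z i] v_def
      by (simp add: mult_minus_distrib_mat_vec[OF Q])
    show "v i \<in> carrier_vec d" using gsg_carrier[OF B] by (simp add: v_def)
  qed
  define R where "R = mat_of_rows d (map v [0..<r])"
  have R: "R \<in> carrier_mat r d" by (simp add: R_def mat_of_rows_def)
  have P: "pseudoinverse A\<^sup>T \<in> carrier_mat d r" using pseudoinverse_carrier[of "A\<^sup>T" r d] A by simp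
  have "map (\<lambda>i. gsg f (x0 + Q *\<^sub>v z + col (Q * A) i) (map ((*) Q) Bs ! i)
      - gsg f (x0 + Q *\<^sub>v z) (map ((*) Q) Bs ! i)) [0..<dim_col (Q * A)]
    = map ((*\<^sub>v) Q) (map v [0..<r])"
    using row A by simp
  then have "gsh f (x0 + Q *\<^sub>v z) (Q * A) (map ((*) Q) Bs)
    = Q * pseudoinverse A\<^sup>T * mat_of_rows n (map ((*\<^sub>v) Q) (map v [0..<r]))"
    unfolding gsh_def pseudoinverse_embed[OF A] using Q by simp
  also have "mat_of_rows n (map ((*\<^sub>v) Q) (map v [0..<r])) = R * Q\<^sup>T"
    unfolding R_def by (rule mat_of_rows_mult_mat_vec[OF Q]) (use v in auto)
  also have "Q * pseudoinverse A\<^sup>T * (R * Q\<^sup>T) = Q * (pseudoinverse A\<^sup>T * R) * Q\<^sup>T"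
    using assoc_mult_mat[OF mult_carrier_mat[OF Q P] R, of "Q\<^sup>T" n] assoc_mult_mat[OF Q P R] Q
    by simp
  also have "pseudoinverse A\<^sup>T * R = gsh fhat z A Bs"
    unfolding gsh_def R_def v_def using A by simp
  finally show ?thesis .
qed

section \<open>Transfer of the summands and of their linear combinations\<close>

context
  fixes Y Yhat :: "real vec set"
  assumes Y: "Y \<subseteq> {x0 + Q *\<^sub>v u |u. u \<in> carrier_vec d}"
    and Yhat: "Yhat = {u \<in> carrier_vec d. x0 + Q *\<^sub>v u \<in> Y}"
begin

text \<open>Since the points of the term lie in \<open>Y\<close>, the descriptions
  \<open>hat_point\<close> and \<open>hat_dirs\<close> satisfy their defining equations, which
  brings the term into the form of \<open>gsg_embed\<close>.\<close>

lemma eval_gsg_term_hat: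
  assumes wf: "wf_gsg_term n t" and sub: "gsg_term_points t \<subseteq> Y"
  shows "eval_gsg_term fhat (hat_gsg_term x0 Q Yhat t) \<in> carrier_vec d"
    and "eval_gsg_term f t = Q *\<^sub>v eval_gsg_term fhat (hat_gsg_term x0 Q Yhat t)"
proof -
  obtain c z A where t: "t = GSG_term c z A" by (cases t)
  have A: "dim_row A = n" and z: "z \<in> Y" and zA: "\<And>j. j < dim_col A \<Longrightarrow> z + col A j \<in> Y"
    using wf sub unfolding t by (auto simp: gsg_points_def)
  define zh Ah where "zh = hat_point x0 Q Yhat z" and "Ah = hat_dirs Q A"
  have zh: "zh \<in> carrier_vec d" "z = x0 + Q *\<^sub>v zh"
    using hat_point[OF x0 Q orth Y Yhat z] Yhat unfolding zh_def by auto
  have Ah: "Ah \<in> carrier_mat d (dim_col A)" "A = Q * Ah"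
    using hat_dirs[OF x0 Q orth Y Yhat A z zA] unfolding Ah_def by auto
  have th: "hat_gsg_term x0 Q Yhat t = GSG_term c zh Ah" by (simp add: t zh_def Ah_def)
  show "eval_gsg_term fhat (hat_gsg_term x0 Q Yhat t) \<in> carrier_vec d"
    using gsg_carrier[OF Ah(1)] by (simp add: th)
  show "eval_gsg_term f t = Q *\<^sub>v eval_gsg_term fhat (hat_gsg_term x0 Q Yhat t)"
    using gsg_embed[OF Ah(1) zh(1)] mult_mat_vec[OF Q gsg_carrier[OF Ah(1)]]
    unfolding th unfolding t by (simp flip: zh(2) Ah(2))
qed

text \<open>Transposition and scaling both respect the form \<open>Q * H * Q\<^sup>T\<close>, so
  \<open>gsh_embed\<close> covers either value of the flag.\<close>

lemma eval_gsh_term_hat: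
  assumes wf: "wf_gsh_term n t" and sub: "gsh_term_points t \<subseteq> Y"
  shows "eval_gsh_term fhat (hat_gsh_term x0 Q Yhat t) \<in> carrier_mat d d"
    and "eval_gsh_term f t = Q * eval_gsh_term fhat (hat_gsh_term x0 Q Yhat t) * Q\<^sup>T"
proof -
  obtain c tr z A Bs where t: "t = GSH_term c tr z A Bs" by (cases t)
  have A: "dim_row A = n" and z: "z \<in> Y" and zA: "\<And>j. j < dim_col A \<Longrightarrow> z + col A j \<in> Y"
    and len: "length Bs = dim_col A"
    using wf sub unfolding t by (auto simp: gsh_points_def)
  have zB: "z + col (Bs ! i) j \<in> Y" if "i < dim_col A" "j < dim_col (Bs ! i)" for i j
    using sub that unfolding t gsh_term_points.simps gsh_points_def by blast
  have B: "dim_row (Bs ! i) = n" if "i < dim_col A" for i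
    using wf len that unfolding t by auto
  define zh Ah Bh where "zh = hat_point x0 Q Yhat z" and "Ah = hat_dirs Q A"
    and "Bh = map (hat_dirs Q) Bs"
  have zh: "zh \<in> carrier_vec d" "z = x0 + Q *\<^sub>v zh"
    using hat_point[OF x0 Q orth Y Yhat z] Yhat unfolding zh_def by auto
  have Ah: "Ah \<in> carrier_mat d (dim_col A)" "A = Q * Ah"
    using hat_dirs[OF x0 Q orth Y Yhat A z zA] unfolding Ah_def by auto
  \<comment> \<open>A GSH also uses the points \<open>z + col (Bs ! i) j\<close>; the columns of
    each \<open>Bs ! i\<close> are therefore differences of points of \<open>Y\<close> and factor
    through \<open>Q\<close>.\<close>
  have Bh: "hat_dirs Q (Bs ! i) \<in> carrier_mat d (dim_col (Bs ! i))" "Bs ! i = Q * hat_dirs Q (Bs ! i)"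
    if "i < dim_col A" for i
    by (rule hat_dirs[OF x0 Q orth Y Yhat B[OF that] z zB[OF that]]; assumption)+
  have Bs: "Bs = map ((*) Q) Bh"
    by (rule nth_equalityI) (use Bh(2) len in \<open>auto simp: Bh_def\<close>)
  have dBh: "\<forall>M\<in>set Bh. dim_row M = d"
    using Bh(1) len by (force simp: Bh_def in_set_conv_nth)
  have lBh: "length Bh = dim_col A" using len by (simp add: Bh_def)
  have th: "hat_gsh_term x0 Q Yhat t = GSH_term c tr zh Ah Bh"
    by (simp add: t zh_def Ah_def Bh_def)
  define H where "H = gsh fhat zh Ah Bh"
  have H: "H \<in> carrier_mat d d" using gsh_carrier[OF Ah(1)] by (simp add: H_def)
  have Qt: "Q\<^sup>T \<in> carrier_mat d n" using Q by simp
  have fH: "gsh f z A Bs = Q * H * Q\<^sup>T"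
    using gsh_embed[OF Ah(1) zh(1) lBh dBh] unfolding H_def by (simp flip: zh(2) Ah(2) Bs)
  have QH: "Q * H \<in> carrier_mat n d" using Q H by simp
  have "(Q * H * Q\<^sup>T)\<^sup>T = Q * (H\<^sup>T * Q\<^sup>T)"
    using transpose_mult[OF QH Qt] transpose_mult[OF Q H] by simp
  then have tr: "(Q * H * Q\<^sup>T)\<^sup>T = Q * H\<^sup>T * Q\<^sup>T"
    using Q H Qt by simp
  define K where "K = (if tr then H\<^sup>T else H)"
  have K: "K \<in> carrier_mat d d" using H by (simp add: K_def)
  have eh: "eval_gsh_term fhat (hat_gsh_term x0 Q Yhat t) = c \<cdot>\<^sub>m K"
    unfolding th K_def H_def by simp
  have ef: "eval_gsh_term f t = c \<cdot>\<^sub>m (Q * K * Q\<^sup>T)"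
    unfolding t eval_gsh_term.simps fH K_def using tr by simp
  show "eval_gsh_term fhat (hat_gsh_term x0 Q Yhat t) \<in> carrier_mat d d"
    using K by (simp add: eh)
  have "Q * (c \<cdot>\<^sub>m K) * Q\<^sup>T = c \<cdot>\<^sub>m (Q * K) * Q\<^sup>T" using mult_smult_distrib[OF Q K] by simp
  also have "\<dots> = c \<cdot>\<^sub>m (Q * K * Q\<^sup>T)" using Q K by (intro mult_smult_assoc_mat) auto
  finally show "eval_gsh_term f t = Q * eval_gsh_term fhat (hat_gsh_term x0 Q Yhat t) * Q\<^sup>T"
    unfolding eh ef by simp
qed

text \<open>The dimension claim is part of the induction because distributing \<open>Q\<close> over
  the sum needs both summands in \<open>carrier_vec d\<close>.\<close>

lemma qgsd_gradient_hat:
  assumes "\<And>t. t \<in> set gs \<Longrightarrow> wf_gsg_term n t \<and> gsg_term_points t \<subseteq> Y"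
  shows "qgsd_gradient d fhat (map (hat_gsg_term x0 Q Yhat) gs) \<in> carrier_vec d
    \<and> qgsd_gradient n f gs = Q *\<^sub>v qgsd_gradient d fhat (map (hat_gsg_term x0 Q Yhat) gs)"
  using assms
proof (induction gs)
  case Nil
  then show ?case using Q by (auto simp: qgsd_gradient_def)
next
  case (Cons t gs)
  then show ?case
    using eval_gsg_term_hat[of t]
    by (simp add: qgsd_gradient_def mult_add_distrib_mat_vec[OF Q])
qed

lemma qgsd_hessian_hat:
  assumes "\<And>t. t \<in> set hs \<Longrightarrow> wf_gsh_term n t \<and> gsh_term_points t \<subseteq> Y"
  shows "qgsd_hessian d fhat (map (hat_gsh_term x0 Q Yhat) hs) \<in> carrier_mat d d
    \<and> qgsd_hessian n f hs = Q * qgsd_hessian d fhat (map (hat_gsh_term x0 Q Yhat) hs) * Q\<^sup>T"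
  using assms
proof (induction hs)
  case Nil
  then show ?case using Q by (simp add: qgsd_hessian_def)
next
  case (Cons t hs)
  let ?E = "eval_gsh_term fhat (hat_gsh_term x0 Q Yhat t)"
  let ?H = "qgsd_hessian d fhat (map (hat_gsh_term x0 Q Yhat) hs)"
  have E: "?E \<in> carrier_mat d d" "eval_gsh_term f t = Q * ?E * Q\<^sup>T"
    using eval_gsh_term_hat[of t] Cons.prems by auto
  have H: "?H \<in> carrier_mat d d" "qgsd_hessian n f hs = Q * ?H * Q\<^sup>T"
    using Cons by auto
  have "Q * (?E + ?H) * Q\<^sup>T = Q * ?E * Q\<^sup>T + Q * ?H * Q\<^sup>T"
    unfolding mult_add_distrib_mat[OF Q E(1) H(1)]
    using Q E(1) H(1) by (intro add_mult_distrib_mat) auto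
  then show ?case using E H by (simp add: qgsd_hessian_def)
qed

end

end

section \<open>The orthogonal complement and equality of the models\<close>

lemma transpose_mult_col_perp:
  assumes Q: "Q \<in> carrier_mat n d" and w: "w \<in> col_perp Q"
  shows "w \<in> carrier_vec n" "Q\<^sup>T *\<^sub>v w = 0\<^sub>v d"
proof -
  interpret vec_space "TYPE(real)" n .
  have perp: "w \<in> carrier_vec n" "\<forall>y\<in>col_space Q. w \<bullet> y = 0"
    using w Q by (auto simp: col_perp_def orthogonal_complement_def)
  then show "w \<in> carrier_vec n" by simp
  \<comment> \<open>The entries of \<open>Q\<^sup>T *\<^sub>v w\<close> are the inner products of
    \<open>w\<close> with the columns of \<open>Q\<close>, and each column lies in the span of all
    of them.\<close>
  have "col Q i \<bullet> w = 0" if i: "i < d" for i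
  proof -
    have "set (cols Q) \<subseteq> carrier_vec n" using Q cols_dim[of Q] by auto
    then have "col Q i \<in> col_space Q"
      using in_own_span[of "set (cols Q)"] i Q by (auto simp: col_space_def cols_def)
    then show ?thesis using perp Q comm_scalar_prod[of w n "col Q i"] by auto
  qed
  then show "Q\<^sup>T *\<^sub>v w = 0\<^sub>v d" using Q by (intro eq_vecI) auto
qed

theorem theorem6:
  fixes f fhat :: "real vec \<Rightarrow> real"
    and x0 :: "real vec" and S Q :: "real mat" and T :: "real mat list"
    and n d p :: nat and q :: "nat \<Rightarrow> nat"
    and Y Yhat :: "real vec set"
    and gs :: "gsg_term list" and hs :: "gsh_term list"
    and x xhat :: "real vec"
  assumes x0: "x0 \<in> carrier_vec n"
    and S: "S \<in> carrier_mat n p"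
    and T_length: "length T = p"
    and T: "\<And>i. i < p \<Longrightarrow> T ! i \<in> carrier_mat n (q i)"
    and Y_def: "Y = {x0} \<union> {x0 + col S i |i. i < p}
      \<union> {x0 + col (T ! i) j |i j. i < p \<and> j < q i}
      \<union> {x0 + col S i + col (T ! i) j |i j. i < p \<and> j < q i}"
    and Y_affine: "Y \<subseteq> {x0 + Q *\<^sub>v u |u. u \<in> carrier_vec d}"
    and d_less_n: "d < n"
    and Q: "Q \<in> carrier_mat n d"
    and Q_orthonormal: "orthonormal_cols Q"
    and fhat_def: "\<And>u. u \<in> carrier_vec d \<Longrightarrow> fhat u = f (x0 + Q *\<^sub>v u)"
    and Yhat_def: "Yhat = {u \<in> carrier_vec d. x0 + Q *\<^sub>v u \<in> Y}"
    and qgsd: "is_qgsd_data n Y gs hs"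
    and x: "x \<in> carrier_vec n"
    and xhat: "xhat \<in> carrier_vec d"
    and x_coset: "x \<in> {x0 + Q *\<^sub>v xhat + w |w. w \<in> col_perp Q}"
  shows "qgsd_model f x0 gs hs x
    = qgsd_model fhat (0\<^sub>v d)
        (map (hat_gsg_term x0 Q Yhat) gs) (map (hat_gsh_term x0 Q Yhat) hs) xhat"
proof -
  obtain w where w: "w \<in> col_perp Q" and x_eq: "x = x0 + Q *\<^sub>v xhat + w" using x_coset by blast
  note w' = transpose_mult_col_perp[OF Q w]
  have Qt: "Q\<^sup>T \<in> carrier_mat d n" and Qx: "Q *\<^sub>v xhat \<in> carrier_vec n" using Q xhat by auto
  define y where "y = x - x0"
  have y: "y \<in> carrier_vec n" using x x0 by (simp add: y_def)
  have y_eq: "y = Q *\<^sub>v xhat + w"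
    unfolding y_def x_eq using x0 Qx w'(1) by (intro eq_vecI) auto
  have Qty: "Q\<^sup>T *\<^sub>v y = xhat"
    unfolding y_eq mult_add_distrib_mat_vec[OF Qt Qx w'(1)] w'(2)
    using assoc_mult_mat_vec[OF Qt Q xhat] orthonormal_cols_gram[OF Q Q_orthonormal] xhat by simp
  have gs: "wf_gsg_term n t \<and> gsg_term_points t \<subseteq> Y" if "t \<in> set gs" for t
    using qgsd that unfolding is_qgsd_data_def by auto
  have hs: "wf_gsh_term n t \<and> gsh_term_points t \<subseteq> Y" if "t \<in> set hs" for t
    using qgsd that unfolding is_qgsd_data_def by auto
  define G where "G = qgsd_gradient d fhat (map (hat_gsg_term x0 Q Yhat) gs)"
  define H where "H = qgsd_hessian d fhat (map (hat_gsh_term x0 Q Yhat) hs)"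
  have G: "G \<in> carrier_vec d" "qgsd_gradient n f gs = Q *\<^sub>v G"
    using qgsd_gradient_hat[where f = f and fhat = fhat, OF x0 Q Q_orthonormal fhat_def Y_affine Yhat_def gs]
    unfolding G_def by auto
  have H: "H \<in> carrier_mat d d" "qgsd_hessian n f hs = Q * H * Q\<^sup>T"
    using qgsd_hessian_hat[where f = f and fhat = fhat, OF x0 Q Q_orthonormal fhat_def Y_affine Yhat_def hs]
    unfolding H_def by auto
  \<comment> \<open>Adjointness moves \<open>Q\<close> across the inner product, where
    \<open>Q\<^sup>T *\<^sub>v y\<close> is \<open>xhat\<close>. With \<open>v = G\<close> this
    settles the linear term.\<close>
  have adj: "(Q *\<^sub>v v) \<bullet> y = v \<bullet> xhat" if v: "v \<in> carrier_vec d" for v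
    using transpose_vec_mult_scalar[OF Q v y] Qty comm_scalar_prod[OF xhat v]
      comm_scalar_prod[OF y mult_mat_vec_carrier[OF Q v]] by simp
  have Hx: "H *\<^sub>v xhat \<in> carrier_vec d" using H(1) xhat by simp
  \<comment> \<open>The right factor \<open>Q\<^sup>T\<close> turns \<open>y\<close> into
    \<open>xhat\<close>; what remains is adjointness with \<open>v = H *\<^sub>v xhat\<close>, which
    settles the quadratic term.\<close>
  have "Q * H * Q\<^sup>T *\<^sub>v y = Q *\<^sub>v (H *\<^sub>v xhat)"
    using Q Qt H(1) y xhat Qty
    by (simp add: assoc_mult_mat_vec[of _ n d _ n] assoc_mult_mat_vec[of _ n d _ d])
  then have quad: "y \<bullet> (Q * H * Q\<^sup>T *\<^sub>v y) = xhat \<bullet> (H *\<^sub>v xhat)"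
    using adj[OF Hx] comm_scalar_prod[OF y, of "Q *\<^sub>v (H *\<^sub>v xhat)"]
      comm_scalar_prod[OF xhat Hx] Q Hx by simp
  have "Q *\<^sub>v 0\<^sub>v d = 0\<^sub>v n" using Q by (intro eq_vecI) auto
  then have f0: "fhat (0\<^sub>v d) = f x0" using fhat_def[of "0\<^sub>v d"] x0 by simp
  have x0h: "xhat - 0\<^sub>v d = xhat" using xhat by auto
  show ?thesis
    unfolding qgsd_model_def x0h f0 y_def[symmetric] index_zero_vec carrier_vecD[OF x0]
      G_def[symmetric] H_def[symmetric] G(2) H(2) adj[OF G(1)] quad ..
qed

end
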